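(* Let $\mathbb{P}$ be a forcing notion, $Q \subseteq \mathbb{P}$ with $Q \neq \emptyset$, and $n \in \omega \setminus \{0\}$. Write $i_\ast$ for $i_\ast^{\mathbb{P}}$ and $\mathrm{int}$ for $\mathrm{int}^{\mathbb{P}}$. Then: (1) If $Q$ is $m$-linked for some $m < \omega$, then for all $\bar{q} \in {}^{n}Q$, $i_{\ast}(\bar{q}) \geq \min\{m, n\}$. (2) If $\bar{q} \in {}^{n}Q$, then $1 \leq i_{\ast}(\bar{q}) \leq n$. As a consequence, $\mathrm{int}(Q)$ is a real number and it belongs to $[0,1]$. (3) If $Q$ is centered, then for all $\bar{q} \in {}^{n}Q$, $i_{\ast}(\bar{q}) = n$. As a consequence, $\mathrm{int}(Q) = 1$ if, and only if, $Q$ is centered. (4) For any $p \in \mathbb{P}$, $\mathrm{int}(\{p\}) = 1$. (5) If $Q$ is finite, then $\mathrm{int}(Q) \geq \frac{1}{|Q|} > 0$. (6) Let $Q$ be an antichain in $\mathbb{P}$. Then: (a) if $Q$ is finite, then $\mathrm{int}(Q) = \frac{1}{|Q|}$; (b) if $Q$ is infinite, then $\mathrm{int}(Q) = 0$. (7) If $m$ is a natural number with $m > 1$ and $\mathrm{int}(Q) \geq 1 - \frac{1}{m+1}$, then $Q$ is $m$-linked. (8) If $Q \subseteq P \subseteq \mathbb{P}$, then $\mathrm{int}(P) \leq \mathrm{int}(Q)$.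
   Context: A forcing notion is a nonempty preordered set $(\mathbb{P}, \leq)$. An antichain in $\mathbb{P}$ is a set of pairwise incompatible elements (no two distinct elements have a common lower bound). A set $Q \subseteq \mathbb{P}$ is $m$-linked if every subset of $Q$ of size at most $m$ has a lower bound in $\mathbb{P}$, and centered if every finite subset of $Q$ has a lower bound in $\mathbb{P}$. For $\bar{q} = \langle q_i \colon i < n\rangle \in {}^{n}\mathbb{P}$ (a function from $n=\{0,\dots,n-1\}$ to $\mathbb{P}$), $$i_{\ast}^{\mathbb{P}}(\bar{q}) := \max\{ |F| \colon F \subseteq n \text{ and } \{q_i \colon i \in F\} \text{ has a lower bound in } \mathbb{P}\}.$$ The intersection number of $Q\subseteq \mathbb{P}$ in $\mathbb{P}$ is $$\mathrm{int}^{\mathbb{P}}(Q) := \inf\left\{ \frac{i_{\ast}^{\mathbb{P}}(\bar{q})}{n} \colon \bar{q} \in {}^{n}Q,\ n \in \omega \setminus \{0\} \right\}.$$ *)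

theory Defs
  imports "HOL-Library.FuncSet" "HOL-Library.Extended_Real"
begin

text \<open>Throughout, the preorder of a forcing notion on the set \<open>P\<close> is a relation \<open>r\<close>,
  where \<open>(x, y) \<in> r\<close> is read as \<open>x \<le> y\<close>.\<close>

definition forcing_notion :: "'a set \<Rightarrow> 'a rel \<Rightarrow> bool" where
  "forcing_notion P r \<longleftrightarrow> P \<noteq> {} \<and> preorder_on P r"

definition has_lower_bound :: "'a set \<Rightarrow> 'a rel \<Rightarrow> 'a set \<Rightarrow> bool" where
  "has_lower_bound P r A \<longleftrightarrow> (\<exists>p\<in>P. \<forall>a\<in>A. (p, a) \<in> r)"

definition forcing_antichain :: "'a set \<Rightarrow> 'a rel \<Rightarrow> 'a set \<Rightarrow> bool" where
  "forcing_antichain P r Q \<longleftrightarrow>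
     Q \<subseteq> P \<and> pairwise (\<lambda>x y. \<not> has_lower_bound P r {x, y}) Q"

definition m_linked :: "'a set \<Rightarrow> 'a rel \<Rightarrow> nat \<Rightarrow> 'a set \<Rightarrow> bool" where
  "m_linked P r m Q \<longleftrightarrow>
     Q \<subseteq> P \<and> (\<forall>A\<subseteq>Q. finite A \<and> card A \<le> m \<longrightarrow> has_lower_bound P r A)"

definition centered :: "'a set \<Rightarrow> 'a rel \<Rightarrow> 'a set \<Rightarrow> bool" where
  "centered P r Q \<longleftrightarrow>
     Q \<subseteq> P \<and> (\<forall>A\<subseteq>Q. finite A \<longrightarrow> has_lower_bound P r A)"

definition i_star :: "'a set \<Rightarrow> 'a rel \<Rightarrow> nat \<Rightarrow> (nat \<Rightarrow> 'a) \<Rightarrow> nat" where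
  "i_star P r n q = Max {card F | F. F \<subseteq> {..<n} \<and> has_lower_bound P r (q ` F)}"

text \<open>The infimum is taken in the extended reals, where it always exists; that it is a real
  number when \<open>Q\<close> is nonempty is then a statement with content (for \<open>Q = {}\<close> it is \<open>\<infinity>\<close>).\<close>

definition intersection_number :: "'a set \<Rightarrow> 'a rel \<Rightarrow> 'a set \<Rightarrow> ereal" where
  "intersection_number P r Q =
     Inf {ereal (real (i_star P r n q) / real n) | n q. n \<noteq> 0 \<and> q \<in> {..<n} \<rightarrow>\<^sub>E Q}"

end

theory Submission
  imports Defs
begin

text \<open>
  Lower bounds on \<open>i_star\<close> must hold for all tuples. They come from exhibiting a large index set
  on which the tuple has a common lower bound: an initial segment if \<open>Q\<close> is linked, all
  indices if \<open>Q\<close> is centered, and a fibre \<open>{i. q i = a}\<close> if \<open>Q\<close> is finite. In the last case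
  reflexivity makes \<open>a\<close> itself a lower bound, and since the \<open>|Q|\<close> fibres partition the \<open>n\<close> indices,
  one of them has at least \<open>n / |Q|\<close> elements (\<open>le_card_times_i_star\<close>).

  Upper bounds on the intersection number need only one tuple each, and the useful ones enumerate a
  finite subset \<open>A\<close> of \<open>Q\<close> without repetition. If \<open>A\<close> is an antichain, no two of the indices can
  share a lower bound, which gives the bound \<open>1 / |A|\<close>. If \<open>A\<close> merely has no lower bound, then
  \<open>i_star\<close> is an integer below \<open>|A|\<close>, so the intersection number is at most \<open>1 - 1 / |A|\<close>. This gap
  (\<open>has_lower_bound_if_intersection_number_gt\<close>) yields both remaining implications: a value of at
  least \<open>1 - 1 / (m + 1)\<close> exceeds \<open>1 - 1 / |A|\<close> whenever \<open>|A| \<le> m\<close>, so \<open>Q\<close> is \<open>m\<close>-linked, and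
  the value \<open>1\<close> exceeds it for every \<open>A\<close>, so \<open>Q\<close> is centered.
\<close>

section \<open>Lower bounds of subsets\<close>

lemma has_lower_bound_antimono:
  assumes "has_lower_bound P r B" and "A \<subseteq> B"
  shows "has_lower_bound P r A"
  using assms unfolding has_lower_bound_def by blast

lemma has_lower_bound_empty:
  assumes "P \<noteq> {}"
  shows "has_lower_bound P r {}"
  using assms unfolding has_lower_bound_def by blast

lemma has_lower_bound_subset_singleton:
  assumes "forcing_notion P r" and "a \<in> P" and "A \<subseteq> {a}"
  shows "has_lower_bound P r A"
  using assms unfolding has_lower_bound_def forcing_notion_def preorder_on_def refl_on_def by blast

section \<open>Tuples and their largest index sets with a lower bound\<close>

lemma finite_i_star_cards:
  "finite {card F | F. F \<subseteq> {..<n::nat} \<and> has_lower_bound P r (q ` F)}"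
  by (rule finite_subset[of _ "card ` Pow {..<n}"]) auto

lemma card_le_i_star:
  assumes "F \<subseteq> {..<n}" and "has_lower_bound P r (q ` F)"
  shows "card F \<le> i_star P r n q"
  unfolding i_star_def using assms by (intro Max_ge finite_i_star_cards) blast

lemma i_star_attained:
  assumes "P \<noteq> {}"
  obtains F where "F \<subseteq> {..<n}" and "has_lower_bound P r (q ` F)" and "i_star P r n q = card F"
proof -
  have "has_lower_bound P r (q ` {})"
    using has_lower_bound_empty[OF assms] by simp
  then have "{card F | F. F \<subseteq> {..<n} \<and> has_lower_bound P r (q ` F)} \<noteq> {}"
    by blast
  from Max_in[OF finite_i_star_cards this] show thesis
    unfolding i_star_def[symmetric] using that by blast
qed

lemma i_star_le:
  assumes "P \<noteq> {}"
  shows "i_star P r n q \<le> n"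
proof -
  obtain F where "F \<subseteq> {..<n}" "i_star P r n q = card F"
    using i_star_attained[OF assms] by metis
  then show ?thesis
    using card_mono[of "{..<n}" F] by simp
qed

lemma i_star_eq_iff:
  assumes "P \<noteq> {}"
  shows "i_star P r n q = n \<longleftrightarrow> has_lower_bound P r (q ` {..<n})"
proof
  assume eq: "i_star P r n q = n"
  obtain F where F: "F \<subseteq> {..<n}" "has_lower_bound P r (q ` F)" "i_star P r n q = card F"
    using i_star_attained[OF assms] .
  have "F = {..<n}"
    using F eq by (intro card_subset_eq) auto
  with F show "has_lower_bound P r (q ` {..<n})"
    by simp
next
  assume "has_lower_bound P r (q ` {..<n})"
  then have "n \<le> i_star P r n q"
    using card_le_i_star[of "{..<n}" n P r q] by simp
  with i_star_le[OF assms] show "i_star P r n q = n"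
    by (rule antisym)
qed

lemma i_star_ge_1:
  assumes "forcing_notion P r" and "q ` {..<n} \<subseteq> P" and "n \<noteq> 0"
  shows "1 \<le> i_star P r n q"
proof -
  have "has_lower_bound P r (q ` {0})"
    using assms by (intro has_lower_bound_subset_singleton[of P r "q 0"]) auto
  then show ?thesis
    using card_le_i_star[of "{0}" n P r q] assms by simp
qed

lemma i_star_ge_min_if_m_linked:
  assumes "m_linked P r m Q" and "q ` {..<n} \<subseteq> Q"
  shows "min m n \<le> i_star P r n q"
proof -
  have "card (q ` {..<min m n}) \<le> m"
    using card_image_le[of "{..<min m n}" q] by simp
  moreover have "q ` {..<min m n} \<subseteq> Q"
    using assms(2) by auto
  ultimately have "has_lower_bound P r (q ` {..<min m n})"
    using assms(1) unfolding m_linked_def by blast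
  then show ?thesis
    using card_le_i_star[of "{..<min m n}" n P r q] by simp
qed

text \<open>The fibres of \<open>q\<close> partition the \<open>n\<close> indices, and each of them is bounded below by the
  common value of \<open>q\<close> on it.\<close>

lemma le_card_times_i_star:
  assumes "forcing_notion P r" and "finite Q" and "Q \<subseteq> P" and "q ` {..<n} \<subseteq> Q"
  shows "n \<le> card Q * i_star P r n q"
proof -
  have "n = card (\<Union>a\<in>Q. {i\<in>{..<n}. q i = a})"
  proof -
    have "(\<Union>a\<in>Q. {i\<in>{..<n}. q i = a}) = {..<n}"
      using assms(4) by auto
    then show ?thesis
      by simp
  qed
  also have "\<dots> \<le> (\<Sum>a\<in>Q. card {i\<in>{..<n}. q i = a})"
    using assms(2) by (rule card_UN_le)
  also have "\<dots> \<le> (\<Sum>a\<in>Q. i_star P r n q)"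
  proof (rule sum_mono)
    fix a assume "a \<in> Q"
    then have "has_lower_bound P r (q ` {i\<in>{..<n}. q i = a})"
      using assms by (intro has_lower_bound_subset_singleton[of P r a]) auto
    then show "card {i\<in>{..<n}. q i = a} \<le> i_star P r n q"
      by (intro card_le_i_star) auto
  qed
  finally show ?thesis
    by simp
qed

text \<open>Two distinct indices in a set with a common lower bound would yield two distinct compatible
  elements of the antichain.\<close>

lemma i_star_le_1_if_antichain:
  assumes "P \<noteq> {}" and "forcing_antichain P r Q" and "q ` {..<n} \<subseteq> Q" and "inj_on q {..<n}"
  shows "i_star P r n q \<le> 1"
proof -
  obtain F where F: "F \<subseteq> {..<n}" "has_lower_bound P r (q ` F)" "i_star P r n q = card F"
    using i_star_attained[OF assms(1)] .
  have "i = j" if "i \<in> F" "j \<in> F" for i j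
  proof (rule ccontr)
    assume "i \<noteq> j"
    then have "q i \<noteq> q j"
      using that F(1) assms(4) by (meson inj_onD subsetD)
    moreover have "has_lower_bound P r {q i, q j}"
      using F(2) that by (auto intro: has_lower_bound_antimono)
    moreover have "q i \<in> Q" "q j \<in> Q"
      using that F(1) assms(3) by auto
    ultimately show False
      using assms(2) unfolding forcing_antichain_def pairwise_def by blast
  qed
  then have "card F \<le> 1"
    by (auto simp: card_le_Suc0_iff_eq[OF finite_subset[OF F(1)]])
  with F show ?thesis
    by simp
qed

section \<open>General bounds on the intersection number\<close>

lemma intersection_number_le:
  assumes "q \<in> {..<n} \<rightarrow>\<^sub>E Q" and "n \<noteq> 0"
  shows "intersection_number P r Q \<le> ereal (real (i_star P r n q) / real n)"
  unfolding intersection_number_def using assms by (intro Inf_lower) blast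

lemma intersection_number_greatest:
  assumes "\<And>n q. n \<noteq> 0 \<Longrightarrow> q ` {..<n} \<subseteq> Q \<Longrightarrow> c \<le> real (i_star P r n q) / real n"
  shows "ereal c \<le> intersection_number P r Q"
  unfolding intersection_number_def
proof (rule Inf_greatest)
  fix x
  assume "x \<in> {ereal (real (i_star P r n q) / real n) | n q. n \<noteq> 0 \<and> q \<in> {..<n} \<rightarrow>\<^sub>E Q}"
  then obtain n q where "x = ereal (real (i_star P r n q) / real n)" "n \<noteq> 0"
    "q \<in> {..<n} \<rightarrow>\<^sub>E Q"
    by blast
  then show "ereal c \<le> x"
    using assms[of n q] by auto
qed

lemma intersection_number_antimono:
  assumes "Q \<subseteq> P'"
  shows "intersection_number P r P' \<le> intersection_number P r Q"
  unfolding intersection_number_def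
  using PiE_mono[of "{..<_::nat}" "\<lambda>_. Q" "\<lambda>_. P'"] assms by (intro Inf_superset_mono) blast

lemma intersection_number_nonneg: "0 \<le> intersection_number P r Q"
  using intersection_number_greatest[of Q 0 P r] by (simp add: zero_ereal_def)

lemma intersection_number_le_1:
  assumes "P \<noteq> {}" and "Q \<noteq> {}"
  shows "intersection_number P r Q \<le> 1"
proof -
  obtain a where "a \<in> Q"
    using assms(2) by blast
  then have "intersection_number P r Q
      \<le> ereal (real (i_star P r 1 (\<lambda>i\<in>{..<1}. a)) / real 1)"
    by (intro intersection_number_le) auto
  also have "\<dots> \<le> ereal 1"
    using i_star_le[OF assms(1), of r 1] by simp
  finally show ?thesis
    by (simp add: one_ereal_def)
qed

lemma inverse_card_le_intersection_number:
  assumes "forcing_notion P r" and "finite Q" and "Q \<subseteq> P" and "Q \<noteq> {}"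
  shows "ereal (1 / real (card Q)) \<le> intersection_number P r Q"
proof (rule intersection_number_greatest)
  fix n :: nat and q :: "nat \<Rightarrow> 'a"
  assume "n \<noteq> 0" "q ` {..<n} \<subseteq> Q"
  then have "real n \<le> real (card Q) * real (i_star P r n q)"
    using le_card_times_i_star[OF assms(1-3)] by (metis of_nat_le_iff of_nat_mult)
  moreover have "0 < card Q"
    using assms by (simp add: card_gt_0_iff)
  ultimately show "1 / real (card Q) \<le> real (i_star P r n q) / real n"
    using \<open>n \<noteq> 0\<close> by (simp add: field_simps)
qed

section \<open>Linked and centered sets\<close>

lemma injective_enumeration:
  assumes "finite A"
  obtains q :: "nat \<Rightarrow> 'a"
  where "q \<in> {..<card A} \<rightarrow>\<^sub>E A" and "inj_on q {..<card A}" and "q ` {..<card A} = A"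
proof -
  obtain h where "bij_betw h {..<card A} A"
    using ex_bij_betw_nat_finite[OF assms] by (auto simp: atLeast0LessThan)
  moreover have "bij_betw (restrict h {..<card A}) {..<card A} A = bij_betw h {..<card A} A"
    by (rule bij_betw_cong) simp
  ultimately have "bij_betw (restrict h {..<card A}) {..<card A} A"
    by simp
  then show thesis
    by (intro that[of "restrict h {..<card A}"]) (auto simp: bij_betw_def)
qed

text \<open>An injective enumeration of a set \<open>A\<close> without lower bound misses the maximal value \<open>|A|\<close> of
  \<open>i_star\<close>, hence misses it by at least \<open>1\<close>.\<close>

lemma has_lower_bound_if_intersection_number_gt:
  assumes "P \<noteq> {}" and "finite A" and "A \<noteq> {}" and "A \<subseteq> Q"
    and "ereal (1 - 1 / real (card A)) < intersection_number P r Q"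
  shows "has_lower_bound P r A"
proof -
  obtain q where q: "q \<in> {..<card A} \<rightarrow>\<^sub>E A" "q ` {..<card A} = A"
    using injective_enumeration[OF assms(2)] by metis
  have pos: "card A \<noteq> 0"
    using assms by simp
  note assms(5)
  also have "intersection_number P r Q \<le> intersection_number P r A"
    using assms(4) by (rule intersection_number_antimono)
  also have "\<dots> \<le> ereal (real (i_star P r (card A) q) / real (card A))"
    using q(1) pos by (rule intersection_number_le)
  finally have "(real (card A) - 1) / real (card A) < real (i_star P r (card A) q) / real (card A)"
    using pos by (simp add: diff_divide_distrib)
  then have "real (card A) - 1 < real (i_star P r (card A) q)"
    using pos by (simp add: divide_less_cancel)
  then have "i_star P r (card A) q = card A"
    using i_star_le[OF assms(1), of r "card A" q] by linarith
  then show ?thesis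
    using i_star_eq_iff[OF assms(1), of r "card A" q] q(2) by simp
qed

lemma i_star_eq_if_centered:
  assumes "P \<noteq> {}" and "centered P r Q" and "q ` {..<n} \<subseteq> Q"
  shows "i_star P r n q = n"
  using assms unfolding i_star_eq_iff[OF assms(1)] centered_def by blast

lemma intersection_number_eq_1_iff_centered:
  assumes "P \<noteq> {}" and "Q \<subseteq> P" and "Q \<noteq> {}"
  shows "intersection_number P r Q = 1 \<longleftrightarrow> centered P r Q"
proof
  assume eq: "intersection_number P r Q = 1"
  have "has_lower_bound P r A" if "A \<subseteq> Q" "finite A" for A
  proof (cases "A = {}")
    case True
    then show ?thesis
      using has_lower_bound_empty[OF assms(1)] by simp
  next
    case False
    then show ?thesis
      using that eq assms(1)
      by (intro has_lower_bound_if_intersection_number_gt[of P A Q r])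
        (auto simp: one_ereal_def card_gt_0_iff)
  qed
  then show "centered P r Q"
    using assms(2) unfolding centered_def by blast
next
  assume "centered P r Q"
  then have "ereal 1 \<le> intersection_number P r Q"
    by (intro intersection_number_greatest) (simp add: i_star_eq_if_centered[OF assms(1)])
  with intersection_number_le_1[OF assms(1,3)] show "intersection_number P r Q = 1"
    by (simp add: one_ereal_def antisym)
qed

lemma centered_singleton:
  assumes "forcing_notion P r" and "p \<in> P"
  shows "centered P r {p}"
  using assms has_lower_bound_subset_singleton[OF assms] unfolding centered_def by blast

lemma m_linked_if_intersection_number_ge:
  assumes "P \<noteq> {}" and "Q \<subseteq> P"
    and "ereal (1 - 1 / (real m + 1)) \<le> intersection_number P r Q"
  shows "m_linked P r m Q"
proof -
  have "has_lower_bound P r A" if "A \<subseteq> Q" "finite A" "card A \<le> m" for A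
  proof (cases "A = {}")
    case True
    then show ?thesis
      using has_lower_bound_empty[OF assms(1)] by simp
  next
    case False
    then have "0 < card A"
      using that by (simp add: card_gt_0_iff)
    then have "ereal (1 - 1 / real (card A)) < ereal (1 - 1 / (real m + 1))"
      using that by (simp add: field_simps)
    also note assms(3)
    finally show ?thesis
      using that False assms(1) by (intro has_lower_bound_if_intersection_number_gt[of P A Q r])
  qed
  then show ?thesis
    using assms(2) unfolding m_linked_def by blast
qed

section \<open>Antichains\<close>

lemma intersection_number_le_inverse_card_if_antichain:
  assumes "P \<noteq> {}" and "forcing_antichain P r Q" and "A \<subseteq> Q" and "finite A" and "A \<noteq> {}"
  shows "intersection_number P r Q \<le> ereal (1 / real (card A))"
proof -
  obtain q where q: "q \<in> {..<card A} \<rightarrow>\<^sub>E A" "inj_on q {..<card A}" "q ` {..<card A} = A"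
    using injective_enumeration[OF assms(4)] .
  have "intersection_number P r Q \<le> intersection_number P r A"
    using assms(3) by (rule intersection_number_antimono)
  also have "\<dots> \<le> ereal (real (i_star P r (card A) q) / real (card A))"
    using q(1) assms by (intro intersection_number_le) auto
  also have "\<dots> \<le> ereal (1 / real (card A))"
    using i_star_le_1_if_antichain[OF assms(1,2), of q "card A"] q assms(3)
    by (simp add: divide_right_mono)
  finally show ?thesis .
qed

lemma intersection_number_finite_antichain:
  assumes "forcing_notion P r" and "forcing_antichain P r Q" and "finite Q" and "Q \<noteq> {}"
  shows "intersection_number P r Q = ereal (1 / real (card Q))"
proof (rule antisym)
  show "intersection_number P r Q \<le> ereal (1 / real (card Q))"
    using assms unfolding forcing_notion_def
    by (intro intersection_number_le_inverse_card_if_antichain) auto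
  show "ereal (1 / real (card Q)) \<le> intersection_number P r Q"
    using assms unfolding forcing_antichain_def
    by (intro inverse_card_le_intersection_number) auto
qed

lemma intersection_number_infinite_antichain:
  assumes "P \<noteq> {}" and "forcing_antichain P r Q" and "infinite Q"
  shows "intersection_number P r Q = 0"
proof (rule antisym[OF _ intersection_number_nonneg])
  show "intersection_number P r Q \<le> 0"
  proof (rule ereal_le_epsilon2)
    fix e :: real
    assume "0 < e"
    then obtain k where k: "inverse (real (Suc k)) < e"
      using reals_Archimedean by blast
    obtain A where A: "A \<subseteq> Q" "finite A" "card A = Suc k"
      using infinite_arbitrarily_large[OF assms(3)] by blast
    then have "A \<noteq> {}"
      by auto
    have "intersection_number P r Q \<le> ereal (1 / real (card A))"
      using assms(1,2) A(1,2) \<open>A \<noteq> {}\<close>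
      by (rule intersection_number_le_inverse_card_if_antichain)
    also have "\<dots> \<le> 0 + ereal e"
      using k A(3) by (simp add: inverse_eq_divide)
    finally show "intersection_number P r Q \<le> 0 + ereal e" .
  qed
qed

section \<open>Basic properties of the intersection number\<close>

theorem lemma3p3:
  fixes P :: "'a set" and r :: "'a rel" and Q :: "'a set" and n :: nat
  assumes "forcing_notion P r" and "Q \<subseteq> P" and "Q \<noteq> {}" and "n \<noteq> 0"
  shows "(\<forall>m. m_linked P r m Q \<longrightarrow> (\<forall>q \<in> {..<n} \<rightarrow>\<^sub>E Q. i_star P r n q \<ge> min m n)) \<and>
    (\<forall>q \<in> {..<n} \<rightarrow>\<^sub>E Q. 1 \<le> i_star P r n q \<and> i_star P r n q \<le> n) \<and>
    (\<exists>x::real. intersection_number P r Q = ereal x \<and> x \<in> {0..1}) \<and>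
    (centered P r Q \<longrightarrow> (\<forall>q \<in> {..<n} \<rightarrow>\<^sub>E Q. i_star P r n q = n)) \<and>
    (intersection_number P r Q = 1 \<longleftrightarrow> centered P r Q) \<and>
    (\<forall>p\<in>P. intersection_number P r {p} = 1) \<and>
    (finite Q \<longrightarrow> intersection_number P r Q \<ge> ereal (1 / real (card Q)) \<and> 1 / real (card Q) > 0) \<and>
    (forcing_antichain P r Q \<longrightarrow>
           (finite Q \<longrightarrow> intersection_number P r Q = ereal (1 / real (card Q))) \<and>
           (infinite Q \<longrightarrow> intersection_number P r Q = 0)) \<and>
    (\<forall>m::nat. m > 1 \<and> intersection_number P r Q \<ge> ereal (1 - 1 / (real m + 1)) \<longrightarrow> m_linked P r m Q) \<and>
    (\<forall>P'. Q \<subseteq> P' \<and> P' \<subseteq> P \<longrightarrow> intersection_number P r P' \<le> intersection_number P r Q)"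
proof -
  have ne: "P \<noteq> {}"
    using assms(1) unfolding forcing_notion_def by blast
  have real_valued: "\<exists>x::real. intersection_number P r Q = ereal x \<and> x \<in> {0..1}"
    using intersection_number_nonneg[of P r Q] intersection_number_le_1[OF ne assms(3), of r]
    by (cases "intersection_number P r Q") auto
  have finite_case: "ereal (1 / real (card Q)) \<le> intersection_number P r Q \<and> 1 / real (card Q) > 0"
    if "finite Q"
    using that inverse_card_le_intersection_number[OF assms(1) that assms(2,3)] assms(3)
    by (simp add: card_gt_0_iff)
  have singleton: "intersection_number P r {p} = 1" if "p \<in> P" for p
    using that intersection_number_eq_1_iff_centered[OF ne, of "{p}" r]
      centered_singleton[OF assms(1) that] by simp
  have image: "q ` {..<n} \<subseteq> Q" if "q \<in> {..<n} \<rightarrow>\<^sub>E Q" for q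
    using that by auto
  show ?thesis
  proof (intro conjI allI ballI impI; (elim conjE)?)
    show "min m n \<le> i_star P r n q" if "m_linked P r m Q" "q \<in> {..<n} \<rightarrow>\<^sub>E Q" for m q
      using i_star_ge_min_if_m_linked[OF that(1) image[OF that(2)]] .
    show "1 \<le> i_star P r n q" if "q \<in> {..<n} \<rightarrow>\<^sub>E Q" for q
      using i_star_ge_1[OF assms(1) subset_trans[OF image[OF that] assms(2)] assms(4)] .
    show "i_star P r n q = n" if "centered P r Q" "q \<in> {..<n} \<rightarrow>\<^sub>E Q" for q
      using i_star_eq_if_centered[OF ne that(1) image[OF that(2)]] .
  qed (use real_valued singleton finite_case i_star_le[OF ne]
      intersection_number_eq_1_iff_centered[OF ne assms(2,3)]
      intersection_number_finite_antichain[OF assms(1) _ _ assms(3)]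
      intersection_number_infinite_antichain[OF ne]
      m_linked_if_intersection_number_ge[OF ne assms(2)]
      intersection_number_antimono in simp_all)
qed

end
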